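(* If $\Lambda\subseteq\mathbb{Z}_{\ge0}^k$ is a non-exceptional $k$-dimensional Young diagram, then $|\mathrm{precorn}(\Lambda)|\ge k$, i.e. $\Lambda$ has at least $k$ precorner cells.
   Context: Let $k\in\mathbb{Z}_{>0}$; $e_1,\ldots,e_k$ is the standard basis of $\mathbb{Z}^k$. On $\mathbb{Z}_{\ge0}^k$ consider the product order: $\lambda\preccurlyeq\mu$ means $\lambda_i\le\mu_i$ for all $i$. A Young diagram of dimension $k$ is a finite subset $\Lambda\subseteq\mathbb{Z}_{\ge0}^k$ such that $\mu\in\Lambda$, $\lambda\in\mathbb{Z}_{\ge 0}^k$ and $\lambda\preccurlyeq\mu$ imply $\lambda\in\Lambda$; it is assumed that for any $1\le i\le k$ there is $\lambda\in\Lambda$ with $\lambda_i\ne0$. Elements of $\Lambda$ are called cells. A corner cell is a maximal element of $\Lambda$ with respect to $\preccurlyeq$; the set of corner cells is $\mathrm{corn}(\Lambda)$. A non-corner cell $\lambda\in\Lambda$ is a precorner cell if for every $1\le i\le k$ either $\lambda+e_i\notin\Lambda$ or $\lambda+e_i\in\mathrm{corn}(\Lambda)$; the set of precorner cells is $\mathrm{precorn}(\Lambda)$. The diagram $\Lambda$ is exceptional with respect to the $i$-th coordinate if every $\lambda\in\Lambda$ satisfies $\lambda_i=0$ or $\lambda=e_i$. It is non-exceptional if it is not exceptional with respect to the $i$-th coordinate for every $1\le i\le k$. *)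

theory Defs
  imports "HOL-Analysis.Finite_Cartesian_Product"
begin

text \<open>
  Points of \<open>\<int>\<^sub>\<ge>\<^sub>0\<^sup>k\<close> are vectors of type \<open>nat ^ 'k\<close> with \<open>k = CARD('k) > 0\<close>. The library order on
  this type is the product order, and \<open>axis i 1\<close> is the standard basis vector \<open>e\<^sub>i\<close>.
\<close>

text \<open>The last conjunct forces the diagram to be truly \<open>k\<close>-dimensional; in particular it is
  nonempty.\<close>

definition young_diagram :: "(nat ^ 'k::finite) set \<Rightarrow> bool" where
  "young_diagram \<Lambda> \<longleftrightarrow>
     finite \<Lambda> \<and>
     (\<forall>y\<in>\<Lambda>. \<forall>x. x \<le> y \<longrightarrow> x \<in> \<Lambda>) \<and>
     (\<forall>i. \<exists>x\<in>\<Lambda>. x $ i \<noteq> 0)"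

definition corn :: "(nat ^ 'k::finite) set \<Rightarrow> (nat ^ 'k) set" where
  "corn \<Lambda> = {x \<in> \<Lambda>. \<forall>y\<in>\<Lambda>. x \<le> y \<longrightarrow> y = x}"

definition precorn :: "(nat ^ 'k::finite) set \<Rightarrow> (nat ^ 'k) set" where
  "precorn \<Lambda> = {x \<in> \<Lambda>. x \<notin> corn \<Lambda> \<and>
     (\<forall>i. x + axis i 1 \<notin> \<Lambda> \<or> x + axis i 1 \<in> corn \<Lambda>)}"

definition exceptional_wrt :: "(nat ^ 'k::finite) set \<Rightarrow> 'k \<Rightarrow> bool" where
  "exceptional_wrt \<Lambda> i \<longleftrightarrow> (\<forall>x\<in>\<Lambda>. x $ i = 0 \<or> x = axis i 1)"

definition non_exceptional :: "(nat ^ 'k::finite) set \<Rightarrow> bool" where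
  "non_exceptional \<Lambda> \<longleftrightarrow> (\<forall>i. \<not> exceptional_wrt \<Lambda> i)"

end

theory Submission
  imports Defs "HOL-Analysis.Cartesian_Euclidean_Space"
begin

text \<open>
  The precorner cells are the maximal elements of \<open>\<Lambda> - corn \<Lambda>\<close>, and they span \<open>\<real>\<^sup>k\<close>. Otherwise some
  \<open>w \<noteq> 0\<close> is orthogonal to all of them, so the positive and the negative part of \<open>w\<close> define the same
  weight on precorner cells. Among the precorner cells of maximal weight take one, \<open>p\<close>, for which
  the sum of the coordinates \<open>i\<close> with \<open>w\<^sub>i = 0\<close> is maximal. Some \<open>p + e\<^sub>l\<close> is a corner, so for
  \<open>j \<noteq> l\<close> with \<open>p\<^sub>j > 0\<close> the cell \<open>p + e\<^sub>l - e\<^sub>j\<close> lies below a precorner cell. Taking \<open>j\<close> with \<open>w\<^sub>j\<close>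
  of sign opposite to \<open>w\<^sub>l\<close> (or of any nonzero sign if \<open>w\<^sub>l = 0\<close>) contradicts the choice of \<open>p\<close>.
\<close>

text \<open>A maximal element \<open>q\<close> of \<open>\<Lambda> - corn \<Lambda>\<close> above
  \<open>x\<close> works: each \<open>q + axis i 1\<close> is strictly larger, so it cannot be a
  non-corner cell.\<close>

lemma noncorner_le_precorner:
  assumes "finite \<Lambda>" "x \<in> \<Lambda>" "x \<notin> corn \<Lambda>"
  obtains q where "q \<in> precorn \<Lambda>" "x \<le> q"
proof -
  have "finite (\<Lambda> - corn \<Lambda>)" "x \<in> \<Lambda> - corn \<Lambda>"
    using assms by auto
  from finite_has_maximal2[OF this] obtain q where
    q: "q \<in> \<Lambda> - corn \<Lambda>" "x \<le> q" "\<And>y. y \<in> \<Lambda> - corn \<Lambda> \<Longrightarrow> q \<le> y \<Longrightarrow> q = y"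
    by metis
  have "q + axis i 1 \<notin> \<Lambda> \<or> q + axis i 1 \<in> corn \<Lambda>" for i
  proof -
    have "q \<le> q + axis i 1" by (simp add: less_eq_vec_def)
    moreover have "q \<noteq> q + axis i 1" by (auto simp: vec_eq_iff axis_def)
    ultimately show ?thesis using q(3) by blast
  qed
  then have "q \<in> precorn \<Lambda>"
    using q(1) by (auto simp: precorn_def)
  then show thesis using q(2) that by blast
qed

text \<open>The direction \<open>l\<close> depends on \<open>p\<close> alone, so \<open>j\<close>
  can be chosen afterwards according to the sign of \<open>w l\<close>. Only coordinate
  \<open>j\<close> may drop.\<close>

lemma precorner_exchange:
  fixes \<Lambda> :: "(nat ^ 'k::finite) set"
  assumes "young_diagram \<Lambda>" "p \<in> precorn \<Lambda>"
  obtains l where "\<And>j. j \<noteq> l \<Longrightarrow> p $ j > 0 \<Longrightarrow>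
    \<exists>q\<in>precorn \<Lambda>. p $ l < q $ l \<and> (\<forall>i. i \<noteq> j \<longrightarrow> p $ i \<le> q $ i)"
proof -
  have fin: "finite \<Lambda>" and down: "\<And>x y. y \<in> \<Lambda> \<Longrightarrow> x \<le> y \<Longrightarrow> x \<in> \<Lambda>"
    using assms(1) by (auto simp: young_diagram_def)
  from assms(2) obtain y where y: "y \<in> \<Lambda>" "p \<le> y" "y \<noteq> p"
    by (auto simp: precorn_def corn_def)
  then obtain l where "p $ l < y $ l"
    by (metis less_eq_vec_def order_le_imp_less_or_eq vec_eq_iff)
  with y(2) have "p + axis l 1 \<le> y"
    by (auto simp: less_eq_vec_def axis_def)
  then have c: "p + axis l 1 \<in> \<Lambda>"
    using down y(1) by blast
  show thesis
  proof (rule that[of l])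
    fix j assume j: "j \<noteq> l" "p $ j > 0"
    \<comment> \<open>This is \<open>p + e_l - e_j\<close>; the truncated subtraction is exact
      because \<open>p $ j > 0\<close>. Lying strictly below a cell, \<open>x\<close> is not a
      corner.\<close>
    define x where "x = (\<chi> i. if i = j then p $ i - 1 else (p + axis l 1) $ i)"
    have "x \<le> p + axis l 1"
      using j by (auto simp: x_def less_eq_vec_def axis_def)
    moreover have "x \<noteq> p + axis l 1"
      using j by (auto simp: x_def vec_eq_iff axis_def intro!: exI[of _ j])
    ultimately have "x \<in> \<Lambda>" "x \<notin> corn \<Lambda>"
      using down c by (auto simp: corn_def)
    then obtain q where q: "q \<in> precorn \<Lambda>" "x \<le> q"
      using noncorner_le_precorner[OF fin] by blast
    have "p $ l < q $ l"
      using q(2)[unfolded less_eq_vec_def, rule_format, of l] j by (simp add: x_def axis_def)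
    moreover have "p $ i \<le> q $ i" if "i \<noteq> j" for i
      using q(2)[unfolded less_eq_vec_def, rule_format, of i] that by (simp add: x_def)
    ultimately show "\<exists>q\<in>precorn \<Lambda>. p $ l < q $ l \<and> (\<forall>i. i \<noteq> j \<longrightarrow> p $ i \<le> q $ i)"
      using q(1) by blast
  qed
qed

text \<open>Non-exceptionality enters here: it gives a cell strictly above \<open>axis i 1\<close>,
  which is therefore not a corner.\<close>

lemma below_precorner_axis:
  fixes \<Lambda> :: "(nat ^ 'k::finite) set"
  assumes "young_diagram \<Lambda>" "non_exceptional \<Lambda>"
  obtains p where "p \<in> precorn \<Lambda>" "p $ i > 0"
proof -
  have fin: "finite \<Lambda>" and down: "\<And>x y. y \<in> \<Lambda> \<Longrightarrow> x \<le> y \<Longrightarrow> x \<in> \<Lambda>"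
    using assms(1) by (auto simp: young_diagram_def)
  obtain x where x: "x \<in> \<Lambda>" "x $ i \<noteq> 0" "x \<noteq> axis i 1"
    using assms(2) by (auto simp: non_exceptional_def exceptional_wrt_def)
  then have "axis i 1 \<le> x"
    by (auto simp: less_eq_vec_def axis_def)
  then have "axis i 1 \<in> \<Lambda>" "axis i 1 \<notin> corn \<Lambda>"
    using down x by (auto simp: corn_def)
  then obtain p where p: "p \<in> precorn \<Lambda>" "axis i 1 \<le> p"
    using noncorner_le_precorner[OF fin] by blast
  have "p $ i > 0"
    using p(2)[unfolded less_eq_vec_def, rule_format, of i] by simp
  then show thesis using p(1) that by blast
qed

text \<open>Fits the exchange step: the one coordinate that may drop carries weight zero.\<close>

lemma weight_mono:
  fixes p q :: "nat ^ 'k::finite" and a :: "'k \<Rightarrow> real"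
  assumes "\<And>i. a i \<ge> 0" "a j = 0" "\<And>i. i \<noteq> j \<Longrightarrow> p $ i \<le> q $ i"
  shows "(\<Sum>i\<in>UNIV. a i * real (p $ i)) \<le> (\<Sum>i\<in>UNIV. a i * real (q $ i))"
proof (rule sum_mono)
  fix i show "a i * real (p $ i) \<le> a i * real (q $ i)"
    using assms by (cases "i = j") (auto intro: mult_left_mono)
qed

lemma weight_strict_mono:
  fixes p q :: "nat ^ 'k::finite" and a :: "'k \<Rightarrow> real"
  assumes "\<And>i. a i \<ge> 0" "a j = 0" "\<And>i. i \<noteq> j \<Longrightarrow> p $ i \<le> q $ i" "a l > 0" "p $ l < q $ l"
  shows "(\<Sum>i\<in>UNIV. a i * real (p $ i)) < (\<Sum>i\<in>UNIV. a i * real (q $ i))"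
proof (rule sum_strict_mono_ex1)
  show "\<forall>i\<in>UNIV. a i * real (p $ i) \<le> a i * real (q $ i)"
  proof
    fix i show "a i * real (p $ i) \<le> a i * real (q $ i)"
      using assms(1-3) by (cases "i = j") (auto intro: mult_left_mono)
  qed
  show "\<exists>i\<in>UNIV. a i * real (p $ i) < a i * real (q $ i)"
    using assms(4,5) by (intro bexI[of _ l]) auto
qed simp

lemma weight_pos:
  fixes p :: "nat ^ 'k::finite" and a :: "'k \<Rightarrow> real"
  assumes "\<And>i. a i \<ge> 0"
  shows "(\<Sum>i\<in>UNIV. a i * real (p $ i)) > 0 \<longleftrightarrow> (\<exists>i. a i > 0 \<and> p $ i > 0)"
proof -
  have "(\<Sum>i\<in>UNIV. a i * real (p $ i)) \<ge> 0"
    using assms by (intro sum_nonneg) simp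
  then have "(\<Sum>i\<in>UNIV. a i * real (p $ i)) > 0 \<longleftrightarrow> (\<Sum>i\<in>UNIV. a i * real (p $ i)) \<noteq> 0"
    by linarith
  also have "\<dots> \<longleftrightarrow> (\<exists>i. a i * real (p $ i) \<noteq> 0)"
    using assms by (subst sum_nonneg_eq_0_iff) auto
  also have "\<dots> \<longleftrightarrow> (\<exists>i. a i > 0 \<and> p $ i > 0)"
    unfolding mult_eq_0_iff of_nat_eq_0_iff de_Morgan_disj neq0_conv less_le[of 0 "a _"]
    using assms by metis
  finally show ?thesis .
qed

lemma precorners_not_orthogonal:
  fixes \<Lambda> :: "(nat ^ 'k::finite) set" and w :: "'k \<Rightarrow> real"
  assumes yd: "young_diagram \<Lambda>" and ne: "non_exceptional \<Lambda>"
    and orth: "\<And>p. p \<in> precorn \<Lambda> \<Longrightarrow> (\<Sum>i\<in>UNIV. w i * real (p $ i)) = 0"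
  shows "w i = 0"
proof (rule ccontr)
  assume wi: "w i \<noteq> 0"
  define a b c :: "'k \<Rightarrow> real" where
    "a = (\<lambda>i. max (w i) 0)" and "b = (\<lambda>i. max (- w i) 0)" and
    "c = (\<lambda>i. if w i = 0 then 1 else 0)"
  have nonneg: "\<And>i. a i \<ge> 0" "\<And>i. b i \<ge> 0" "\<And>i. c i \<ge> 0"
    by (auto simp: a_def b_def c_def)
  define W where "W = (\<lambda>a (p :: nat ^ 'k). \<Sum>i\<in>UNIV. a i * real (p $ i))"
  have eq: "W b p = W a p" if "p \<in> precorn \<Lambda>" for p
  proof -
    have "W a p - W b p = (\<Sum>i\<in>UNIV. w i * real (p $ i))"
      unfolding W_def sum_subtractf[symmetric]
      by (rule sum.cong) (auto simp: a_def b_def max_def)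
    then show ?thesis using orth[OF that] by simp
  qed
  have fin: "finite (precorn \<Lambda>)"
    using yd by (auto simp: young_diagram_def precorn_def)
  obtain p0 where p0: "p0 \<in> precorn \<Lambda>" "p0 $ i > 0"
    using below_precorner_axis[OF yd ne] by blast
  \<comment> \<open>Coordinate \<open>i\<close> contributes to one of the two weights, and the
    weights agree on precorner cells.\<close>
  have "W a p0 > 0 \<or> W b p0 > 0"
    unfolding W_def weight_pos[of a, OF nonneg(1)] weight_pos[of b, OF nonneg(2)]
    using wi p0(2) by (auto simp: a_def b_def less_max_iff_disj neq_iff)
  then have pos0: "W a p0 > 0" using eq[OF p0(1)] by simp
  define M where "M = Max (W a ` precorn \<Lambda>)"
  have M: "W a q \<le> M" if "q \<in> precorn \<Lambda>" for q
    using fin that by (simp add: M_def)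
  define S where "S = {q \<in> precorn \<Lambda>. W a q = M}"
  have "M \<in> W a ` precorn \<Lambda>"
    unfolding M_def using fin p0(1) by (intro Max_in) auto
  then have "finite S" "S \<noteq> {}" using fin by (auto simp: S_def)
  then have "Max (W c ` S) \<in> W c ` S" by (intro Max_in) auto
  then obtain p where p: "p \<in> S" "W c p = Max (W c ` S)" by auto
  have pmax: "W c q \<le> W c p" if "q \<in> S" for q
    using \<open>finite S\<close> that p(2) by simp
  have pp: "p \<in> precorn \<Lambda>" "W a p = M" using p(1) by (auto simp: S_def)
  have "W a p > 0" "W b p > 0"
    using pos0 M[OF p0(1)] pp eq[OF pp(1)] by auto
  \<comment> \<open>Both weights of \<open>p\<close> are positive, so \<open>p\<close> has positive
    coordinates of either sign of \<open>w\<close>, available for lowering.\<close>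
  then obtain s t where s: "a s > 0" "p $ s > 0" and t: "b t > 0" "p $ t > 0"
    unfolding W_def weight_pos[of a, OF nonneg(1)] weight_pos[of b, OF nonneg(2)] by blast
  have ws: "w s > 0" and wt: "w t < 0"
    using s(1) t(1) by (auto simp: a_def b_def)
  obtain l where l: "\<And>j. j \<noteq> l \<Longrightarrow> p $ j > 0 \<Longrightarrow>
    \<exists>q\<in>precorn \<Lambda>. p $ l < q $ l \<and> (\<forall>i. i \<noteq> j \<longrightarrow> p $ i \<le> q $ i)"
    using precorner_exchange[OF yd pp(1)] by blast
  consider "w l > 0" | "w l < 0" | "w l = 0" by linarith
  then show False
  proof cases
    \<comment> \<open>Lowering \<open>t\<close> is invisible to \<open>a\<close>, while raising
      \<open>l\<close> increases the \<open>a\<close>-weight beyond its maximum.\<close>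
    case 1
    then obtain q where q: "q \<in> precorn \<Lambda>" "p $ l < q $ l" "\<And>i. i \<noteq> t \<Longrightarrow> p $ i \<le> q $ i"
      using l[of t] wt t(2) by force
    have "W a p < W a q"
      unfolding W_def using q 1 wt
      by (intro weight_strict_mono[of a t p q l] nonneg) (auto simp: a_def)
    then show False using M[OF q(1)] pp(2) by simp
  next
    \<comment> \<open>The mirror case: the \<open>b\<close>-weight grows, and with it the equal
      \<open>a\<close>-weight.\<close>
    case 2
    then obtain q where q: "q \<in> precorn \<Lambda>" "p $ l < q $ l" "\<And>i. i \<noteq> s \<Longrightarrow> p $ i \<le> q $ i"
      using l[of s] ws s(2) by force
    have "W b p < W b q"
      unfolding W_def using q 2 ws
      by (intro weight_strict_mono[of b s p q l] nonneg) (auto simp: b_def)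
    then show False using M[OF q(1)] pp eq[OF q(1)] eq[OF pp(1)] by simp
  next
    \<comment> \<open>Lowering \<open>s\<close> might reduce the \<open>a\<close>-weight, but the
      \<open>b\<close>-weight cannot fall and equals it at \<open>q\<close>. So \<open>q\<close> is
      again of maximal weight, and the tie-breaker \<open>c\<close> grows at
      \<open>l\<close>.\<close>
    case 3
    then obtain q where q: "q \<in> precorn \<Lambda>" "p $ l < q $ l" "\<And>i. i \<noteq> s \<Longrightarrow> p $ i \<le> q $ i"
      using l[of s] ws s(2) by force
    have "W b p \<le> W b q"
      unfolding W_def using q ws
      by (intro weight_mono[of b s p q] nonneg) (auto simp: b_def)
    then have "q \<in> S"
      using M[OF q(1)] pp eq[OF q(1)] eq[OF pp(1)] q(1) by (simp add: S_def)
    moreover have "W c p < W c q"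
      unfolding W_def using q 3 ws
      by (intro weight_strict_mono[of c s p q l] nonneg) (auto simp: c_def)
    ultimately show False using pmax by fastforce
  qed
qed

theorem proposition5:
  fixes \<Lambda> :: "(nat ^ 'k::finite) set"
  assumes "young_diagram \<Lambda>"
    and "non_exceptional \<Lambda>"
  shows "card (precorn \<Lambda>) \<ge> CARD('k)"
proof -
  define f :: "nat ^ 'k \<Rightarrow> real ^ 'k" where "f = (\<lambda>p. \<chi> i. real (p $ i))"
  have fin: "finite (precorn \<Lambda>)"
    using assms(1) by (auto simp: young_diagram_def precorn_def)
  have "span (f ` precorn \<Lambda>) = UNIV"
  proof (rule ccontr)
    assume "span (f ` precorn \<Lambda>) \<noteq> UNIV"
    \<comment> \<open>A proper subspace lies in a hyperplane; \<open>w\<close> is its normal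
      vector.\<close>
    then obtain w where w: "w \<noteq> 0" "span (f ` precorn \<Lambda>) \<subseteq> {x. w \<bullet> x = 0}"
      using span_not_univ_subset_hyperplane by blast
    have "w $ i = 0" for i
    proof (rule precorners_not_orthogonal[OF assms])
      fix p assume "p \<in> precorn \<Lambda>"
      then have "w \<bullet> f p = 0" using w(2) span_base by blast
      then show "(\<Sum>i\<in>UNIV. w $ i * real (p $ i)) = 0"
        by (simp add: f_def inner_vec_def)
    qed
    then show False using w(1) by (simp add: vec_eq_iff)
  qed
  then have "DIM(real ^ 'k) \<le> card (f ` precorn \<Lambda>)"
    using fin by (metis dim_UNIV dim_le_card dim_span finite_imageI order_refl top_greatest)
  also have "\<dots> \<le> card (precorn \<Lambda>)" using fin by (rule card_image_le)
  finally show ?thesis by simp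
qed

end
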